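(* Let $Q$ be an acyclic quiver of type $\widetilde{\mathbb{D}}$ with $n$ vertices. (a) For all non-leaf vertices $i$ and all $t,p\in\mathbb{Z}_{\ge0}$, $$f_i(t+3p(n-3))=(C_{2p}(n)+1)\,f_i(t+2p(n-3))-(C_{2p}(n)+1)\,f_i(t+p(n-3))+f_i(t).$$ (b) For all leaf vertices $i$ and all $t\in\mathbb{Z}_{\ge0}$, $$f_i(t+2(n-3))=C_1(n)\,f_i(t+(n-3))-f_i(t)\quad\text{if } n \text{ is odd},$$ $$f_i(t+4(n-3))=C_2(n)\,f_i(t+2(n-3))-f_i(t)\quad\text{for all } n.$$
   Context: Type $\widetilde{\mathbb{D}}$ with $n\ge5$ vertices (usually denoted $\widetilde{\mathbb{D}}_{n-1}$): the underlying graph consists of a path of $n-4$ vertices (the non-leaf vertices) with two further vertices attached to each end of the path (the four leaf vertices; for $n=5$ all four are attached to the single non-leaf vertex). Any orientation is allowed. Label the vertices $1,\dots,n$ so that $i>j$ whenever there is an arrow $i\to j$. Define $f_i(t)$ ($i\in Q_0$, $t\in\mathbb{Z}_{\ge 0}$) recursively by $f_i(0)=1$ and $$f_i(t+1)=\frac{1+\prod_{j\to i}f_j(t)\ \prod_{j\leftarrow i}f_j(t+1)}{f_i(t)},$$ the products running over all arrows ending at $i$, respectively starting at $i$. Definition of $C_j(n)$ (it depends on the orientation of $Q$). $Q$ is the quiver of a (tagged) triangulation $T$ of the disk with two punctures and $n-3$ marked points on the boundary: the $n-4$ non-leaf vertices are arcs between boundary points that separate the two punctures, and the two leaves at each end are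 the two arcs incident to one puncture. These two arcs either join the puncture to two neighbouring boundary points (when one leaf arrow points towards and the other away from the non-leaf vertex), or are the plain and the notched version of the same arc $r$ (when both leaf arrows have the same direction); in the latter case replace the notched arc by the loop $\ell$ around $r$, so that $r,\ell$ bound a self-folded triangle, both leaves having the arrows determined by $\ell$. This gives an ideal triangulation $T^\circ$, and arrows of $Q$ record, in each triangle, pairs of sides consecutive in clockwise order (the choice of orientation convention does not affect the numbers below). Let $L$ be the closed simple curve around the two punctures, and $X_L$ its Laurent polynomial in the initial cluster variables $x_1,\dots,x_n$ (its lambda length $2\cosh(\mathrm{length}(L)/2)$ in terms of the lambda lengths $x_i$ of the arcs of $T$, boundary segments having lambda length $1$). The $k$-bracelet $\mathrm{Brac}_k(L)$ is the $k$-fold concatenation of $L$, with $X_{\mathrm{Brac}_0(L)}=2$, $X_{\mathrm{Brac}_1(L)}=X_L$, $X_{\mathrm{Brac}_k(L)}=X_LX_{\mathrm{Brac}_{k-1}(L)}-X_{\mathrm{Brac}_{k-2}(L)}$. Then $C_j(n)=X_{\mathrm{Brac}_j(L)}|_{x_1=\cdots=x_n=1}$ for $j\in\mathbb{Z}_{\ge0}$. Concretely: traverse $L$ once, with minimal crossings with $T^\circ$; between consecutive crossings $L$ runs through a triangle of $T^\circ$ and cuts off one of its corners, which lies to the left or to the right of $L$. Let $M$ be the product, in order, of the matrices $\begin{pmatrix}1&1\\0&1\end{pmatrix}$ (corner on the left) and $\begin{pmatrix}1&0\\1&1\end{pmatrix}$ (corner on the right). Then $C_1(n)=\operatorname{tr}(M)$,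 $C_0(n)=2$, and $C_j(n)=C_1(n)C_{j-1}(n)-C_{j-2}(n)$ for $j\ge2$. *)

theory Defs
  imports "HOL-Analysis.Analysis"
begin

section \<open>Acyclic quivers of affine type D\<close>

text \<open>
  A quiver without multiple arrows is a set of pairs, \<open>(i, j)\<close> being an arrow from \<open>i\<close> to \<open>j\<close>.
  The list \<open>ps\<close> is the path of non-leaf vertices, \<open>l\<close> and \<open>r\<close> are the pairs of leaves attached to
  its first and to its last vertex. If the path has one vertex (\<open>n = 5\<close>), then \<open>l\<close> and \<open>r\<close> are an
  arbitrary division of the four leaves into two pairs.
\<close>

definition affine_D_edges :: "nat \<times> nat \<Rightarrow> nat list \<Rightarrow> nat \<times> nat \<Rightarrow> nat set set" where
  "affine_D_edges l ps r =
     {{fst l, hd ps}, {snd l, hd ps}, {fst r, last ps}, {snd r, last ps}} \<union>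
     {{ps ! k, ps ! Suc k} | k. Suc k < length ps}"

text \<open>
  Arrows decrease the label, so the quiver is acyclic and every edge is oriented in exactly one way.
\<close>

definition affine_D_quiver ::
    "nat \<Rightarrow> (nat \<times> nat) set \<Rightarrow> nat \<times> nat \<Rightarrow> nat list \<Rightarrow> nat \<times> nat \<Rightarrow> bool" where
  "affine_D_quiver n Q l ps r \<longleftrightarrow>
     n \<ge> 5 \<and> length ps = n - 4 \<and>
     distinct ([fst l, snd l] @ ps @ [fst r, snd r]) \<and>
     set ([fst l, snd l] @ ps @ [fst r, snd r]) = {1..n} \<and>
     (\<forall>(i, j) \<in> Q. i > j) \<and>
     (\<lambda>(i, j). {i, j}) ` Q = affine_D_edges l ps r"


section \<open>The recursion\<close>

text \<open>
  The conjunct \<open>j < i\<close> is only needed for termination: it holds for all arrows from \<open>i\<close> to \<open>j\<close> of a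
  quiver labelled as above.
\<close>

function frieze :: "(nat \<times> nat) set \<Rightarrow> nat \<Rightarrow> nat \<Rightarrow> real" where
  "frieze Q i 0 = 1"
| "frieze Q i (Suc t) =
     (1 + (\<Prod>j | (j, i) \<in> Q. frieze Q j t) *
          (\<Prod>j | (i, j) \<in> Q \<and> j < i. frieze Q j (Suc t))) / frieze Q i t"
  by pat_completeness auto
termination
  by (relation "measures [\<lambda>(Q, i, t). t, \<lambda>(Q, i, t). i]") auto

declare frieze.simps(2) [simp del]

lemma frieze_Suc:
  assumes "affine_D_quiver n Q l ps r"
  shows "frieze Q i (Suc t) =
     (1 + (\<Prod>j | (j, i) \<in> Q. frieze Q j t) *
          (\<Prod>j | (i, j) \<in> Q. frieze Q j (Suc t))) / frieze Q i t"
proof -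
  have "{j. (i, j) \<in> Q \<and> j < i} = {j. (i, j) \<in> Q}"
    using assms by (auto simp: affine_D_quiver_def)
  then show ?thesis
    using frieze.simps(2)[of Q i t] by simp
qed


section \<open>The ideal triangulation and the curve around the two punctures\<close>

text \<open>
  The arc corresponding to the vertex \<open>i\<close> of the quiver is \<open>Arc i\<close>; different boundary segments need
  not be distinguished. A triangle is the list of its three sides in clockwise order; an arrow from
  \<open>i\<close> to \<open>j\<close> means that \<open>Arc j\<close> follows \<open>Arc i\<close> clockwise in a triangle.
\<close>

datatype side = Arc nat | Boundary

text \<open>
  The triangle with two arcs \<open>Arc i\<close>, \<open>Arc j\<close> joined by an arrow and with one boundary segment.
\<close>

definition boundary_triangle :: "(nat \<times> nat) set \<Rightarrow> nat \<Rightarrow> nat \<Rightarrow> side list" where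
  "boundary_triangle Q i j =
     (if (i, j) \<in> Q then [Arc i, Arc j, Boundary] else [Arc j, Arc i, Boundary])"

text \<open>
  \<open>(T, a, b)\<close> stands for a curve which enters the triangle \<open>T\<close> through the side \<open>T ! a\<close> and leaves it
  through \<open>T ! b\<close>. Positions are used instead of sides since two sides of a self-folded triangle
  coincide.
\<close>

type_synonym passage = "side list \<times> nat \<times> nat"

text \<open>
  The two sides which the curve crosses meet in the corner that it cuts off. This corner is on the
  left of the curve iff the side of exit follows the side of entry clockwise.
\<close>

fun corner_on_left :: "passage \<Rightarrow> bool" where
  "corner_on_left (T, a, b) \<longleftrightarrow> b = Suc a mod 3"

fun passage_matrix :: "passage \<Rightarrow> real^2^2" where
  "passage_matrix P =
     (if corner_on_left P then vector [vector [1, 1], vector [0, 1]]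
      else vector [vector [1, 0], vector [1, 1]])"

definition forward_passage :: "(nat \<times> nat) set \<Rightarrow> nat \<Rightarrow> nat \<Rightarrow> passage" where
  "forward_passage Q i j =
     (boundary_triangle Q i j, if (i, j) \<in> Q then (0, 1) else (1, 0))"

definition backward_passage :: "(nat \<times> nat) set \<Rightarrow> nat \<Rightarrow> nat \<Rightarrow> passage" where
  "backward_passage Q i j =
     (boundary_triangle Q i j, if (i, j) \<in> Q then (1, 0) else (0, 1))"

text \<open>
  Leaf arrows \<open>v \<rightarrow> a\<close> and \<open>b \<rightarrow> v\<close>: the arcs \<open>Arc a\<close> and \<open>Arc b\<close> join the puncture to the two endpoints
  of \<open>Arc v\<close>, and the puncture lies on the triangles \<open>[Arc v, Arc a, Arc b]\<close> and
  \<open>[Arc b, Arc a, Boundary]\<close>. With the puncture on its left, the curve crosses \<open>Arc v\<close>, \<open>Arc b\<close>,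
  \<open>Arc a\<close>, \<open>Arc v\<close>.
\<close>

definition mixed_turn :: "nat \<Rightarrow> nat \<Rightarrow> nat \<Rightarrow> passage list" where
  "mixed_turn v a b =
     [([Arc v, Arc a, Arc b], 0, 2),
      ([Arc b, Arc a, Boundary], 0, 1),
      ([Arc v, Arc a, Arc b], 1, 0)]"

text \<open>
  Leaf arrows of the same direction: \<open>Arc a\<close> is the radius and \<open>Arc b\<close> the loop around it (replacing
  the notched arc). The loop is a side of a triangle with \<open>Arc v\<close> and a boundary segment, and it
  bounds the self-folded triangle \<open>[Arc b, Arc a, Arc a]\<close>. With the puncture on its left, the curve
  crosses \<open>Arc v\<close>, \<open>Arc b\<close>, \<open>Arc a\<close>, \<open>Arc b\<close>, \<open>Arc v\<close>. It reaches the radius from the side at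
  position 2 and leaves it at position 1.
\<close>

definition self_folded_turn :: "(nat \<times> nat) set \<Rightarrow> nat \<Rightarrow> nat \<Rightarrow> nat \<Rightarrow> passage list" where
  "self_folded_turn Q v a b =
     [forward_passage Q v b,
      ([Arc b, Arc a, Arc a], 0, 2),
      ([Arc b, Arc a, Arc a], 1, 0),
      backward_passage Q v b]"

fun puncture_turn :: "(nat \<times> nat) set \<Rightarrow> nat \<Rightarrow> nat \<times> nat \<Rightarrow> passage list" where
  "puncture_turn Q v (a, b) =
     (if (v, a) \<in> Q \<and> (b, v) \<in> Q then mixed_turn v a b
      else if (v, b) \<in> Q \<and> (a, v) \<in> Q then mixed_turn v b a
      else self_folded_turn Q v a b)"

text \<open>
  The closed curve, traversed once with both punctures on its left: from the first to the last arc
  of \<open>ps\<close>, around the puncture at that end, back to the first arc and around the other puncture.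
\<close>

definition curve_L :: "(nat \<times> nat) set \<Rightarrow> nat \<times> nat \<Rightarrow> nat list \<Rightarrow> nat \<times> nat \<Rightarrow> passage list" where
  "curve_L Q l ps r =
     map (\<lambda>k. forward_passage Q (ps ! k) (ps ! Suc k)) [0..<length ps - 1] @
     puncture_turn Q (last ps) r @
     rev (map (\<lambda>k. backward_passage Q (ps ! k) (ps ! Suc k)) [0..<length ps - 1]) @
     puncture_turn Q (hd ps) l"

definition curve_matrix :: "passage list \<Rightarrow> real^2^2" where
  "curve_matrix Ps = foldr (**) (map passage_matrix Ps) (mat 1)"

text \<open>
  \<open>bracelet x k\<close> is the value of the \<open>k\<close>-bracelet of a closed curve of value \<open>x\<close>.
\<close>

fun bracelet :: "real \<Rightarrow> nat \<Rightarrow> real" where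
  "bracelet x 0 = 2"
| "bracelet x (Suc 0) = x"
| "bracelet x (Suc (Suc k)) = x * bracelet x (Suc k) - bracelet x k"

definition growth_coeff ::
    "(nat \<times> nat) set \<Rightarrow> nat \<times> nat \<Rightarrow> nat list \<Rightarrow> nat \<times> nat \<Rightarrow> nat \<Rightarrow> real" where
  "growth_coeff Q l ps r j = bracelet (trace (curve_matrix (curve_L Q l ps r))) j"

end

theory Submission
  imports Defs
begin

text \<open>
  The values of the frieze are lambda lengths of arcs in the disk with two punctures, and one step of
  time rotates every arc by one boundary point. This geometry is made algebraic as follows. Put
  \<open>m = n - 3\<close>. Horocycles at the lifts of the boundary points are vectors \<open>v x\<close> of the plane with
  \<open>det2 (v x) (v (x + 1)) = 1\<close>, and \<open>v (x + m) = M (v x)\<close>, where \<open>M = - T\<^sub>u T\<^sub>u\<^sub>'\<close> is a product of two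
  transvections, one for each puncture. The value at a leaf is \<open>det2 (v x) u\<close> or \<open>det2 (v x) u'\<close>, up to
  a factor that alternates between \<open>w\<close> and \<open>1 / w\<close> since the tag of the arc changes in every step. The
  value at a non-leaf vertex is \<open>det2 (v x) u * det2 (v y) u - det2 (v x) (v y)\<close>, where \<open>y - x\<close> is
  fixed. The exchange relations become identities between determinants
  (\<open>monodromic_sequence.arc_lambda_Ptolemy\<close> and its companions at the two ends of the quiver), and
  since the recursion determines the frieze, it suffices to find \<open>v\<close>, \<open>u\<close> and \<open>u'\<close> with the right
  initial values. Reading off one period of \<open>v\<close> from the strip of triangles along the path of the
  quiver does this for every orientation (\<open>slice_realization\<close>, \<open>frieze_realization\<close>).

  After \<open>m\<close> steps each vector has been multiplied by \<open>M\<close>, which has determinant 1 and trace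
  \<open>c = det2 u u'\<^sup>2 - 2\<close>. By the theorem of Cayley and Hamilton the leaf values satisfy a recurrence of
  order two with coefficient \<open>c\<close>, or \<open>bracelet c 2\<close> if the tags force an even number of turns. Up to
  an invariant constant, a non-leaf value is a product of two solutions of that recurrence, which gives
  a recurrence of order three with coefficient \<open>bracelet c (2 p) + 1\<close> over \<open>p\<close> turns
  (\<open>monodromic_sequence.arc_lambda_recurrence\<close>). Finally, the matrix of the closed curve is
  \<open>A (r r\<^sup>T - J) A\<^sup>T (q q\<^sup>T - J)\<close>, where \<open>A\<close> comes from the same strip of triangles, \<open>q\<close> and \<open>r\<close>
  come from the leaves, and \<open>J\<close> is the rotation by a right angle; its trace is
  \<open>(q\<^sup>T A r)\<^sup>2 - 2 = c\<close> (\<open>growth_coeff_eq\<close>).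
\<close>


section \<open>Transvections\<close>

definition det2 :: "real \<times> real \<Rightarrow> real \<times> real \<Rightarrow> real" where
  "det2 a b = fst a * snd b - snd a * fst b"

definition transvection :: "real \<times> real \<Rightarrow> real \<times> real \<Rightarrow> real \<times> real" where
  "transvection u z = z + det2 z u *\<^sub>R u"

text \<open>
  The transvections \<open>T\<^sub>u\<close> and \<open>T\<^sub>u\<^sub>'\<close> represent the parabolic loops around the two punctures, so their
  product represents the boundary loop, which is freely homotopic to the curve around both
  punctures. With this sign the trace is \<open>det2 u u'\<^sup>2 - 2\<close>, the lambda length of that curve, and not
  its negative.
\<close>

definition monodromy :: "real \<times> real \<Rightarrow> real \<times> real \<Rightarrow> real \<times> real \<Rightarrow> real \<times> real" where
  "monodromy u u' z = - transvection u (transvection u' z)"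

lemma det2_transvection: "det2 (transvection u a) (transvection u b) = det2 a b"
  by (simp add: det2_def transvection_def algebra_simps)

lemma det2_transvection_fixed: "det2 (transvection u a) u = det2 a u"
  by (simp add: det2_def transvection_def algebra_simps)

lemma transvection_inverse: "transvection u (z - det2 z u *\<^sub>R u) = z"
proof -
  have "det2 (z - det2 z u *\<^sub>R u) u = det2 z u"
    by (simp add: det2_def algebra_simps)
  then show ?thesis by (simp add: transvection_def)
qed

lemma det2_uminus [simp]: "det2 (- a) b = - det2 a b" "det2 a (- b) = - det2 a b"
  by (simp_all add: det2_def)

lemma det2_monodromy: "det2 (monodromy u u' a) (monodromy u u' b) = det2 a b"
  by (simp add: monodromy_def det2_transvection)

text \<open>
  This is the theorem of Cayley and Hamilton for the monodromy, which has determinant 1 and trace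
  \<open>det2 u u'\<^sup>2 - 2\<close>, applied to \<open>z\<close> and paired with \<open>b\<close>.
\<close>

lemma det2_monodromy_twice:
  "det2 (monodromy u u' (monodromy u u' z)) b =
     ((det2 u u')\<^sup>2 - 2) * det2 (monodromy u u' z) b - det2 z b"
  by (simp add: det2_def transvection_def monodromy_def algebra_simps power2_eq_square)

text \<open>
  With \<open>P = - T\<^sub>u\<^sup>-\<^sup>1\<close>, the left-hand side is \<open>det2 a (P M b)\<close>, where \<open>P M = T\<^sub>u\<^sub>'\<close>: arcs that are
  described relative to the puncture \<open>u\<close> are thereby described relative to the puncture \<open>u'\<close>.
\<close>

lemma det2_monodromy_right:
  "det2 a u * det2 (monodromy u u' b) u - det2 a (monodromy u u' b) =
     det2 a b + det2 a u' * det2 b u'"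
  by (simp add: det2_def transvection_def monodromy_def algebra_simps)


section \<open>Bracelets\<close>

text \<open>
  The recurrence says that \<open>s (y + m) + s (y - m) = c s y\<close>, and the bracelets are the normalized
  Chebyshev polynomials by which this relation passes from the step \<open>m\<close> to the step \<open>j m\<close>.
\<close>

lemma bracelet_recurrence:
  assumes rec: "\<And>x. s (x + 2 * m) = c * s (x + m) - (s x :: real)"
  shows "j \<le> k \<Longrightarrow> s (x + (k + j) * m) + s (x + (k - j) * m) = bracelet c j * s (x + k * m)"
proof (induction j rule: induct_nat_012)
  case 0
  then show ?case by simp
next
  case 1
  then obtain i where "k = Suc i" by (cases k) auto
  then show ?case
    using rec[of "x + i * m"] by (simp add: mult_2_right algebra_simps)
next
  case (ge2 j)
  from \<open>Suc (Suc j) \<le> k\<close> obtain i where k: "k = i + j + 2"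
    by (metis add.commute add_2_eq_Suc' add_Suc_right le_Suc_ex)
  have up: "s (x + (k + Suc (Suc j)) * m) = c * s (x + (k + Suc j) * m) - s (x + (k + j) * m)"
    using rec[of "x + (k + j) * m"] by (simp add: mult_2_right algebra_simps)
  have down: "s (x + (k - j) * m) = c * s (x + (k - Suc j) * m) - s (x + (k - Suc (Suc j)) * m)"
    using rec[of "x + i * m"] by (simp add: k mult_2_right algebra_simps)
  have "s (x + (k + j) * m) + s (x + (k - j) * m) = bracelet c j * s (x + k * m)"
    "s (x + (k + Suc j) * m) + s (x + (k - Suc j) * m) = bracelet c (Suc j) * s (x + k * m)"
    using ge2 by simp_all
  with up down show ?case
    unfolding bracelet.simps by algebra
qed

lemma bracelet_step:
  assumes "\<And>x. s (x + 2 * m) = c * s (x + m) - (s x :: real)"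
  shows "s (x + 2 * p * m) = bracelet c p * s (x + p * m) - s x"
  using bracelet_recurrence[where s = s, OF assms, of p p x] by (simp add: mult_2)

text \<open>
  The previous lemma applies to the sequence of bracelets itself, whose value at 0 is 2.
\<close>

lemma bracelet_double: "bracelet c (2 * p) = (bracelet c p)\<^sup>2 - 2"
  using bracelet_step[of "bracelet c" 1 c 0 p] by (simp add: power2_eq_square numeral_2_eq_2)


section \<open>Quasi-periodic sequences of plane vectors\<close>

text \<open>
  The vectors \<open>v x\<close> stand for horocycles at the lifts of the \<open>m\<close> marked boundary points to the
  universal cover, in their order along one boundary line. Neighbours have determinant 1, the lambda
  length of a boundary segment, and moving once around the boundary applies the monodromy.
\<close>

locale monodromic_sequence =
  fixes m :: nat and v :: "nat \<Rightarrow> real \<times> real" and u u' :: "real \<times> real"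
  assumes unimodular: "det2 (v x) (v (Suc x)) = 1"
    and monodromy: "v (x + m) = monodromy u u' (v x)"
begin

text \<open>
  Determinants of horocycle vectors are lambda lengths: \<open>left_lambda x\<close> and \<open>right_lambda x\<close> are those
  of the arcs from the boundary point \<open>x\<close> to the two punctures. The third one is
  \<open>det2 (v x) (P (v y))\<close> for \<open>P z = det2 z u u - z\<close>, the lambda length of the arc from \<open>x\<close> to \<open>y\<close>
  that goes around the puncture \<open>u\<close>.
\<close>

definition left_lambda :: "nat \<Rightarrow> real" where
  "left_lambda x = det2 (v x) u"

definition right_lambda :: "nat \<Rightarrow> real" where
  "right_lambda x = det2 (v x) u'"

definition arc_lambda :: "nat \<Rightarrow> nat \<Rightarrow> real" where
  "arc_lambda x y = left_lambda x * left_lambda y - det2 (v x) (v y)"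

lemma arc_lambda_diagonal: "arc_lambda x x = (left_lambda x)\<^sup>2"
  by (simp add: arc_lambda_def det2_def power2_eq_square)

lemma arc_lambda_Suc: "arc_lambda x (Suc x) = left_lambda x * left_lambda (Suc x) - 1"
  by (simp add: arc_lambda_def unimodular)

text \<open>
  This is the Ptolemy relation in the quadrilateral \<open>x, x + 1, y, y + 1\<close>, two sides of which are
  boundary segments. It will be the exchange relation at the non-leaf vertices.
\<close>

lemma arc_lambda_Ptolemy:
  "arc_lambda x y * arc_lambda (Suc x) (Suc y) = 1 + arc_lambda (Suc x) y * arc_lambda x (Suc y)"
proof -
  have "arc_lambda x y * arc_lambda (Suc x) (Suc y) - arc_lambda (Suc x) y * arc_lambda x (Suc y) =
      det2 (v x) (v (Suc x)) * det2 (v y) (v (Suc y))"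
    by (simp add: arc_lambda_def left_lambda_def det2_def algebra_simps)
  then show ?thesis by (simp add: unimodular)
qed

text \<open>
  Beyond a full turn around the boundary, the arc is also determined by the other puncture. This makes
  the two ends of the quiver symmetric: \<open>arc_lambda_diagonal\<close> and \<open>arc_lambda_Suc\<close> have the
  counterparts below.
\<close>

lemma arc_lambda_eq_det2: "arc_lambda x (y + m) = det2 (v x) (v y) + right_lambda x * right_lambda y"
  by (simp add: arc_lambda_def left_lambda_def right_lambda_def monodromy det2_monodromy_right)

lemma arc_lambda_period: "arc_lambda x (x + m) = (right_lambda x)\<^sup>2"
  by (simp add: arc_lambda_eq_det2) (simp add: det2_def power2_eq_square)

lemma arc_lambda_Suc_period: "arc_lambda (Suc x) (x + m) = right_lambda x * right_lambda (Suc x) - 1"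
proof -
  have "det2 (v (Suc x)) (v x) = - det2 (v x) (v (Suc x))"
    by (simp add: det2_def)
  then show ?thesis by (simp add: arc_lambda_eq_det2 unimodular mult.commute)
qed

lemma left_lambda_recurrence:
  "left_lambda (x + 2 * m) = ((det2 u u')\<^sup>2 - 2) * left_lambda (x + m) - left_lambda x"
  using det2_monodromy_twice[of u u' "v x" u] monodromy[of "x + m"] monodromy[of x]
  by (simp add: left_lambda_def mult_2 add.assoc)

lemma right_lambda_recurrence:
  "right_lambda (x + 2 * m) = ((det2 u u')\<^sup>2 - 2) * right_lambda (x + m) - right_lambda x"
  using det2_monodromy_twice[of u u' "v x" u'] monodromy[of "x + m"] monodromy[of x]
  by (simp add: right_lambda_def mult_2 add.assoc)

text \<open>
  As the monodromy has determinant 1, the part \<open>det2 (v x) (v y)\<close> of \<open>arc_lambda x y\<close> is invariant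
  under full turns. All growth is in the product of two solutions of the recurrence for \<open>left_lambda\<close>.
\<close>

lemma det2_shift: "det2 (v (x + p * m)) (v (y + p * m)) = det2 (v x) (v y)"
proof (induction p)
  case (Suc p)
  have "x + Suc p * m = (x + p * m) + m" "y + Suc p * m = (y + p * m) + m" by simp_all
  then show ?case by (simp only: monodromy det2_monodromy Suc)
qed simp

text \<open>
  If two sequences have the eigenvalues \<open>\<mu>\<close> and \<open>1 / \<mu>\<close>, then their product, up to a constant, has
  the eigenvalues \<open>\<mu>\<^sup>2, 1, 1 / \<mu>\<^sup>2\<close>, which gives a recurrence of order three.
\<close>

lemma arc_lambda_recurrence:
  fixes p :: nat
  defines "b \<equiv> bracelet ((det2 u u')\<^sup>2 - 2) (2 * p)"
  shows "arc_lambda (x + 3 * p * m) (y + 3 * p * m) =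
    (b + 1) * arc_lambda (x + 2 * p * m) (y + 2 * p * m)
    - (b + 1) * arc_lambda (x + p * m) (y + p * m) + arc_lambda x y"
proof -
  let ?c = "bracelet ((det2 u u')\<^sup>2 - 2) p"
  have two: "left_lambda (z + 2 * p * m) = ?c * left_lambda (z + p * m) - left_lambda z" for z
    by (rule bracelet_step) (rule left_lambda_recurrence)
  have three: "left_lambda (z + 3 * p * m) =
      ?c * left_lambda (z + 2 * p * m) - left_lambda (z + p * m)" for z
    using two[of "z + p * m"] by (simp add: algebra_simps mult_2_right numeral_3_eq_3)
  have b: "b = ?c\<^sup>2 - 2"
    by (simp add: b_def bracelet_double)
  show ?thesis
    unfolding arc_lambda_def b det2_shift three two by algebra
qed

end


section \<open>Frames along a slice\<close>

text \<open>
  The initial arcs along the path of the quiver form a strip of triangles; \<open>fwd k\<close> says that the \<open>k\<close>-th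
  arrow of the path points away from its first vertex. The \<open>k\<close>-th frame consists of the vectors at the
  two ends of the \<open>k\<close>-th arc. The next arc keeps one end, and the new vector is forced by having
  determinant 1 with both ends of the old arc, because all initial lambda lengths are 1.
\<close>

fun frame :: "(nat \<Rightarrow> bool) \<Rightarrow> nat \<Rightarrow> (real \<times> real) \<times> (real \<times> real)" where
  "frame fwd 0 = ((1, 0), (0, 1))"
| "frame fwd (Suc k) =
     (let (p, w) = frame fwd k in if fwd k then (p - w, w) else (p, w - p))"

lemma det2_frame: "det2 (fst (frame fwd k)) (snd (frame fwd k)) = 1"
  by (induction k) (auto simp: det2_def split_beta Let_def algebra_simps)

fun fwd_count :: "(nat \<Rightarrow> bool) \<Rightarrow> nat \<Rightarrow> nat" where
  "fwd_count fwd 0 = 0"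
| "fwd_count fwd (Suc k) = fwd_count fwd k + (if fwd k then 1 else 0)"

abbreviation bwd_count where "bwd_count fwd \<equiv> fwd_count (\<lambda>k. \<not> fwd k)"

lemma fwd_count_add_bwd_count: "fwd_count fwd k + bwd_count fwd k = k"
  by (induction k) auto

lemma fwd_count_mono: "j \<le> k \<Longrightarrow> fwd_count fwd j \<le> fwd_count fwd k"
  by (induction k) (auto simp: le_Suc_eq)

lemma fst_frame_eq:
  assumes "j \<le> k" "fwd_count fwd j = fwd_count fwd k"
  shows "fst (frame fwd j) = fst (frame fwd k)"
  using assms
proof (induction k)
  case (Suc k)
  show ?case
  proof (cases "j = Suc k")
    case False
    then have "fwd_count fwd j \<le> fwd_count fwd k"
      using Suc.prems fwd_count_mono[of j k fwd] by simp
    then have "\<not> fwd k" "fwd_count fwd j = fwd_count fwd k" using Suc.prems by (auto split: if_splits)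
    then show ?thesis using Suc False by (simp add: split_beta Let_def)
  qed simp
qed simp

lemma snd_frame_eq:
  assumes "j \<le> k" "bwd_count fwd j = bwd_count fwd k"
  shows "snd (frame fwd j) = snd (frame fwd k)"
  using assms
proof (induction k)
  case (Suc k)
  show ?case
  proof (cases "j = Suc k")
    case False
    then have "bwd_count fwd j \<le> bwd_count fwd k"
      using Suc.prems fwd_count_mono[of j k "\<lambda>k. \<not> fwd k"] by simp
    then have "fwd k" "bwd_count fwd j = bwd_count fwd k" using Suc.prems by (auto split: if_splits)
    then show ?thesis using Suc False by (simp add: split_beta Let_def)
  qed simp
qed simp

lemma fwd_count_surj: "i < fwd_count fwd k \<Longrightarrow> \<exists>j<k. fwd_count fwd j = i \<and> fwd j"
  by (induction k) (auto simp: less_Suc_eq split: if_splits)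

text \<open>
  The frames repeat vectors. These two sequences list the distinct vectors on either side of the strip;
  any index with the prescribed count would do in place of the least one.
\<close>

definition first_vector where
  "first_vector fwd i = fst (frame fwd (LEAST k. fwd_count fwd k = i))"

definition second_vector where
  "second_vector fwd i = snd (frame fwd (LEAST k. bwd_count fwd k = i))"

lemma first_vector: "first_vector fwd (fwd_count fwd k) = fst (frame fwd k)"
  unfolding first_vector_def
  by (rule fst_frame_eq) (auto intro: Least_le LeastI)

lemma second_vector: "second_vector fwd (bwd_count fwd k) = snd (frame fwd k)"
  unfolding second_vector_def
  by (rule snd_frame_eq) (auto intro: Least_le LeastI)

lemma det2_first_vector:
  assumes "i < fwd_count fwd k"
  shows "det2 (first_vector fwd (Suc i)) (first_vector fwd i) = 1"
proof -
  obtain j where j: "fwd_count fwd j = i" "fwd j" using fwd_count_surj[OF assms] by blast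
  then show ?thesis
    using first_vector[of fwd j] first_vector[of fwd "Suc j"] det2_frame[of fwd j]
    by (simp add: split_beta Let_def det2_def left_diff_distrib right_diff_distrib mult.commute)
qed

lemma det2_second_vector:
  assumes "i < bwd_count fwd k"
  shows "det2 (second_vector fwd i) (second_vector fwd (Suc i)) = 1"
proof -
  obtain j where j: "bwd_count fwd j = i" "\<not> fwd j" using fwd_count_surj[OF assms] by blast
  then show ?thesis
    using second_vector[of fwd j] second_vector[of fwd "Suc j"] det2_frame[of fwd j]
    by (simp add: split_beta Let_def det2_def left_diff_distrib right_diff_distrib mult.commute)
qed


section \<open>Realization of a slice by a quasi-periodic sequence\<close>

lemma funpow_monodromy_det2:
  "det2 ((monodromy u u' ^^ i) a) ((monodromy u u' ^^ i) b) = det2 a b"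
  by (induction i) (simp_all add: det2_monodromy)

text \<open>
  One period, closed up by the monodromy, determines the sequence.
\<close>

lemma extend_by_monodromy:
  fixes w :: "nat \<Rightarrow> real \<times> real"
  assumes "m > 0" and step: "\<And>i. i < m \<Longrightarrow> det2 (w i) (w (Suc i)) = 1"
    and w: "w m = monodromy u u' (w 0)"
  obtains v where "monodromic_sequence m v u u'" "\<And>i. i \<le> m \<Longrightarrow> v i = w i"
proof
  define v where "v x = (monodromy u u' ^^ (x div m)) (w (x mod m))" for x
  show "monodromic_sequence m v u u'"
  proof
    fix x
    show "v (x + m) = monodromy u u' (v x)"
      using \<open>m > 0\<close> by (simp add: v_def)
    have x: "x mod m < m" using \<open>m > 0\<close> by simp
    have "v (Suc x) = (monodromy u u' ^^ (x div m)) (w (Suc (x mod m)))"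
      using w by (simp add: v_def div_Suc mod_Suc funpow_swap1)
    then show "det2 (v x) (v (Suc x)) = 1"
      by (simp add: v_def funpow_monodromy_det2 step[OF x])
  qed
  show "v i = w i" if "i \<le> m" for i
    using that w \<open>m > 0\<close> by (cases "i = m") (simp_all add: v_def)
qed

text \<open>
  The two sides of the strip together contain every boundary point exactly once, so they are one period
  of the sequence to be built. It is numbered in such a way that the last arc of the path starts at
  point 1, and that point 0, at which the right leaves may start, is included. Points on the second
  side of the strip are seen through \<open>P\<close>, which has to be undone.

  The vectors \<open>u\<close> and \<open>u'\<close> are chosen so that the lambda lengths from the ends of the first arc to the
  left puncture are \<open>q2\<close> and \<open>q1\<close>, and similarly at the other end. The conditions \<open>q1 * q2 = 2\<close> and
  \<open>r1 * r2 = 2\<close> say that the two boundary segments which close up the strip have lambda length 1.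
\<close>

lemma slice_realization:
  fixes fwd :: "nat \<Rightarrow> bool" and K :: nat and q1 q2 r1 r2 :: real
  assumes q: "q1 * q2 = 2" and r: "r1 * r2 = 2"
  defines "x \<equiv> \<lambda>k. Suc (fwd_count fwd K - fwd_count fwd k)"
    and "u \<equiv> (q1, q2)"
    and "u' \<equiv> r1 *\<^sub>R snd (frame fwd K) - r2 *\<^sub>R fst (frame fwd K)"
  obtains v where
    "monodromic_sequence (K + 2) v u u'"
    "monodromic_sequence.left_lambda v u (x 0) = q2"
    "monodromic_sequence.left_lambda v u (Suc (x 0)) = q1"
    "monodromic_sequence.right_lambda v u' 1 = r1" "monodromic_sequence.right_lambda v u' 0 = r2"
    "\<And>k. k \<le> K \<Longrightarrow> monodromic_sequence.arc_lambda v u (x k) (x k + k + 1) = 1"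
proof -
  \<comment> \<open>The value at \<open>0\<close> is the inverse transvection along \<open>u'\<close> of the second end of the last arc,
    so that one turn around the boundary takes it to that end.\<close>
  define w where "w i =
     (if i = 0 then snd (frame fwd K) - det2 (snd (frame fwd K)) u' *\<^sub>R u'
      else if i \<le> x 0 then first_vector fwd (x 0 - i)
      else - transvection u (second_vector fwd (i - x 0 - 1)))" for i
  have K: "x 0 + 1 + bwd_count fwd K = K + 2"
    using fwd_count_add_bwd_count[of fwd K] by (simp add: x_def)
  have pu': "det2 (fst (frame fwd K)) u' = r1" and wu': "det2 (snd (frame fwd K)) u' = r2"
    using det2_frame[of fwd K] unfolding u'_def by (simp_all add: det2_def algebra_simps)
  have first: "w (x k) = fst (frame fwd k)" if "k \<le> K" for k
    using fwd_count_mono[OF that, of fwd] first_vector[of fwd k] by (simp add: w_def x_def)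
  have second: "w (x k + k + 1) = - transvection u (snd (frame fwd k))" if "k \<le> K" for k
  proof -
    have "x k + k + 1 = x 0 + 1 + bwd_count fwd k"
      using fwd_count_mono[OF that, of fwd] fwd_count_add_bwd_count[of fwd k] by (simp add: x_def)
    then show ?thesis using second_vector[of fwd k] by (simp add: w_def)
  qed
  have x_K: "x K = 1" by (simp add: x_def)
  have w0: "transvection u' (w 0) = snd (frame fwd K)"
    by (simp add: w_def transvection_inverse)
  have "w (K + 2) = monodromy u u' (w 0)"
    using second[of K] x_K by (simp add: monodromy_def w0)
  moreover have "det2 (w i) (w (Suc i)) = 1" if "i < K + 2" for i
  proof -
    consider "i = 0" | "1 \<le> i" "i < x 0" | "i = x 0" | "x 0 < i" by linarith
    then show ?thesis
    proof cases
      case 1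
      have "det2 (w 0) (w 1) = det2 (transvection u' (w 0)) (transvection u' (w 1))"
        by (simp add: det2_transvection)
      also have "\<dots> = det2 (snd (frame fwd K)) (transvection u' (fst (frame fwd K)))"
        using first[of K] x_K w0 by simp
      also have "\<dots> = 1"
        using det2_frame[of fwd K] pu' wu' r by (simp add: transvection_def det2_def) algebra
      finally show ?thesis using 1 by simp
    next
      case 2
      then have "x 0 - i = Suc (x 0 - Suc i)" "x 0 - Suc i < fwd_count fwd K"
        by (simp_all add: x_def)
      then show ?thesis using 2 det2_first_vector by (simp add: w_def)
    next
      case 3
      then show ?thesis
        using first[of 0] second[of 0] q by (simp add: transvection_def det2_def u_def)
    next
      case 4
      then have "Suc i - x 0 - 1 = Suc (i - x 0 - 1)" "i - x 0 - 1 < bwd_count fwd K"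
        using K that by simp_all
      then show ?thesis using 4 det2_second_vector by (simp add: w_def det2_transvection)
    qed
  qed
  ultimately obtain v where v: "monodromic_sequence (K + 2) v u u'"
      and v_w: "\<And>i. i \<le> K + 2 \<Longrightarrow> v i = w i"
    using extend_by_monodromy[of "K + 2" w u u'] by auto
  interpret monodromic_sequence "K + 2" v u u' by (fact v)
  have v_first: "v (x k) = fst (frame fwd k)"
    and v_second: "v (x k + k + 1) = - transvection u (snd (frame fwd k))" if "k \<le> K" for k
  proof -
    have "x k + k + 1 \<le> K + 2"
      using that fwd_count_mono[OF that, of fwd] fwd_count_add_bwd_count[of fwd K]
        fwd_count_add_bwd_count[of fwd k]
        fwd_count_mono[OF that, of "\<lambda>k. \<not> fwd k"] by (simp add: x_def)
    then show "v (x k) = fst (frame fwd k)" "v (x k + k + 1) = - transvection u (snd (frame fwd k))"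
      using v_w first[OF that] second[OF that] by simp_all
  qed
  show thesis
  proof
    show "monodromic_sequence (K + 2) v u u'" by (fact v)
    show "left_lambda (x 0) = q2"
      using v_first[of 0]
      by (simp add: left_lambda_def) (simp add: det2_def u_def)
    show "left_lambda (Suc (x 0)) = q1"
      using v_second[of 0]
      by (simp add: left_lambda_def det2_transvection_fixed) (simp add: det2_def u_def)
    show "right_lambda 1 = r1" using v_first[of K] x_K pu' by (simp add: right_lambda_def)
    show "right_lambda 0 = r2"
      using det2_transvection_fixed[of u' "w 0"] w0 wu' v_w[of 0] by (simp add: right_lambda_def)
    show "arc_lambda (x k) (x k + k + 1) = 1" if "k \<le> K" for k
      using v_first[OF that] v_second[OF that] det2_frame[of fwd k]
      unfolding arc_lambda_def left_lambda_def
      by (simp add: det2_transvection_fixed) (simp add: transvection_def det2_def algebra_simps)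
  qed
qed


section \<open>The matrix of the curve\<close>

definition mat22 :: "real \<Rightarrow> real \<Rightarrow> real \<Rightarrow> real \<Rightarrow> real^2^2" where
  "mat22 a b c d = vector [vector [a, b], vector [c, d]]"

lemma mat22_mult:
  "mat22 a b c d ** mat22 a' b' c' d' =
     mat22 (a * a' + b * c') (a * b' + b * d') (c * a' + d * c') (c * b' + d * d')"
  by (simp add: mat22_def vec_eq_iff forall_2 matrix_matrix_mult_def sum_2)

lemma mat22_one: "mat 1 = mat22 1 0 0 1"
  by (simp add: mat22_def vec_eq_iff forall_2 mat_def)

lemma mat22_trace: "trace (mat22 a b c d) = a + d"
  by (simp add: mat22_def trace_def sum_2)

lemma passage_matrix_mat22:
  "passage_matrix P = (if corner_on_left P then mat22 1 1 0 1 else mat22 1 0 1 1)"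
  by (simp add: mat22_def)

lemma curve_matrix_Nil: "curve_matrix [] = mat22 1 0 0 1"
  by (simp add: curve_matrix_def mat22_one)

lemma curve_matrix_Cons: "curve_matrix (P # Ps) = passage_matrix P ** curve_matrix Ps"
  by (simp add: curve_matrix_def)

lemma curve_matrix_append: "curve_matrix (Ps @ Ps') = curve_matrix Ps ** curve_matrix Ps'"
  by (induction Ps) (simp_all add: curve_matrix_def matrix_mul_assoc)

text \<open>
  This is the inverse transpose of the matrix whose columns are the two vectors of the frame. A step of
  the frame multiplies it on the right by the matrix of the passage.
\<close>

definition frame_matrix :: "(real \<times> real) \<times> (real \<times> real) \<Rightarrow> real^2^2" where
  "frame_matrix F =
     mat22 (snd (snd F)) (- snd (fst F)) (- fst (snd F)) (fst (fst F))"

definition frame_matrix_transposed :: "(real \<times> real) \<times> (real \<times> real) \<Rightarrow> real^2^2" where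
  "frame_matrix_transposed F =
     mat22 (snd (snd F)) (- fst (snd F)) (- snd (fst F)) (fst (fst F))"

lemma curve_matrix_forward:
  assumes "\<And>k. k < K \<Longrightarrow> fwd k \<longleftrightarrow> (a k, b k) \<in> Q"
  shows "curve_matrix (map (\<lambda>k. forward_passage Q (a k) (b k)) [0..<K]) = frame_matrix (frame fwd K)"
  using assms
  by (induction K)
    (auto simp: curve_matrix_append curve_matrix_Cons curve_matrix_Nil frame_matrix_def
      passage_matrix_mat22 mat22_mult forward_passage_def split_beta Let_def
      simp del: passage_matrix.simps)

text \<open>
  On the way back the corners are met in reverse order and on the other side. Swapping the sides
  transposes the matrix of a passage, so the product is the transpose of the one for the way there.
\<close>

lemma curve_matrix_backward:
  assumes "\<And>k. k < K \<Longrightarrow> fwd k \<longleftrightarrow> (a k, b k) \<in> Q"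
  shows "curve_matrix (rev (map (\<lambda>k. backward_passage Q (a k) (b k)) [0..<K])) =
    frame_matrix_transposed (frame fwd K)"
  using assms
  by (induction K)
    (auto simp: curve_matrix_append curve_matrix_Cons curve_matrix_Nil frame_matrix_transposed_def
      passage_matrix_mat22 mat22_mult backward_passage_def split_beta Let_def
      simp del: passage_matrix.simps)

text \<open>
  The lambda lengths of the plain arcs from the two ends of the arc \<open>v\<close> to the puncture, up to the
  scaling of the horocycle at the puncture for which plain and notched arcs have equal lambda lengths.
  For leaf arrows of the same direction the initial arcs are the plain and the notched arc at one end,
  so the lambda length is 1 there and 2 at the other end. For leaf arrows of different directions the
  plain and the notched arc at each end have lambda lengths 1 and 2 in some order, with geometric
  mean \<open>\<surd>2\<close>. The first component belongs to the end of \<open>v\<close> at which the leaves with an arrow to \<open>v\<close>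
  start, the second component to the other end.
\<close>

definition turn_weights :: "(nat \<times> nat) set \<Rightarrow> nat \<Rightarrow> nat \<times> nat \<Rightarrow> real \<times> real" where
  "turn_weights Q v ab =
     (case ((v, fst ab) \<in> Q, (v, snd ab) \<in> Q) of
        (True, True) \<Rightarrow> (2, 1)
      | (False, False) \<Rightarrow> (1, 2)
      | _ \<Rightarrow> (sqrt 2, sqrt 2))"

lemma turn_weights_prod: "fst (turn_weights Q v ab) * snd (turn_weights Q v ab) = 2"
  by (simp add: turn_weights_def split: bool.splits)

text \<open>
  This is \<open>q q\<^sup>T - J\<close> with \<open>J\<close> the rotation by a right angle: like a transvection, the turn around a
  puncture is determined by a single vector.
\<close>

definition turn_matrix :: "real \<times> real \<Rightarrow> real^2^2" where
  "turn_matrix q = mat22 ((fst q)\<^sup>2) (fst q * snd q - 1) (fst q * snd q + 1) ((snd q)\<^sup>2)"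

lemma curve_matrix_puncture_turn:
  assumes "(v, a) \<in> Q \<longleftrightarrow> (a, v) \<notin> Q" "(v, b) \<in> Q \<longleftrightarrow> (b, v) \<notin> Q"
  shows "curve_matrix (puncture_turn Q v (a, b)) = turn_matrix (turn_weights Q v (a, b))"
  using assms
  by (cases "(v, a) \<in> Q"; cases "(v, b) \<in> Q")
    (simp_all add: turn_weights_def turn_matrix_def mixed_turn_def self_folded_turn_def
      curve_matrix_Cons curve_matrix_Nil passage_matrix_mat22 mat22_mult
      forward_passage_def backward_passage_def
      del: passage_matrix.simps)

text \<open>
  With \<open>A\<close> the frame matrix, the trace of \<open>A (r r\<^sup>T - J) A\<^sup>T (q q\<^sup>T - J)\<close> is \<open>(q\<^sup>T A r)\<^sup>2 - 2\<close>: the mixed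
  terms vanish because \<open>A J A\<^sup>T = J\<close> is antisymmetric, and \<open>J\<^sup>2 = -1\<close>. Here \<open>q\<^sup>T A r\<close> is the determinant
  of the vectors at the two punctures.
\<close>

lemma trace_curve_matrix:
  fixes q r :: "real \<times> real"
  shows "trace (frame_matrix (frame fwd K) ** (turn_matrix r **
      (frame_matrix_transposed (frame fwd K) ** turn_matrix q))) =
    (det2 q (fst r *\<^sub>R snd (frame fwd K) - snd r *\<^sub>R fst (frame fwd K)))\<^sup>2 - 2"
proof -
  obtain p1 p2 w1 w2 where F: "frame fwd K = ((p1, p2), (w1, w2))" by (metis surj_pair)
  have det: "p1 * w2 - p2 * w1 = 1" using det2_frame[of fwd K] by (simp add: F det2_def)
  have "trace (frame_matrix (frame fwd K) ** (turn_matrix r **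
      (frame_matrix_transposed (frame fwd K) ** turn_matrix q))) =
    (det2 q (fst r *\<^sub>R snd (frame fwd K) - snd r *\<^sub>R fst (frame fwd K)))\<^sup>2
      - 2 * (p1 * w2 - p2 * w1)"
    by (simp add: frame_matrix_def frame_matrix_transposed_def turn_matrix_def mat22_mult
        mat22_trace F det2_def power2_eq_square algebra_simps)
  then show ?thesis unfolding det by simp
qed

text \<open>
  The two vectors are \<open>u\<close> and \<open>u'\<close> of \<open>slice_realization\<close>, so that the value of the closed curve is the
  trace of the monodromy.
\<close>

lemma growth_coeff_eq:
  assumes path: "\<And>k. Suc k < length ps \<Longrightarrow> fwd k \<longleftrightarrow> (ps ! k, ps ! Suc k) \<in> Q"
    and left: "\<And>a. a \<in> {fst l, snd l} \<Longrightarrow> (hd ps, a) \<in> Q \<longleftrightarrow> (a, hd ps) \<notin> Q"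
    and right: "\<And>a. a \<in> {fst r, snd r} \<Longrightarrow> (last ps, a) \<in> Q \<longleftrightarrow> (a, last ps) \<notin> Q"
  defines "F \<equiv> frame fwd (length ps - 1)"
    and "\<rho> \<equiv> turn_weights Q (last ps) r"
  shows "growth_coeff Q l ps r j =
    bracelet ((det2 (turn_weights Q (hd ps) l) (fst \<rho> *\<^sub>R snd F - snd \<rho> *\<^sub>R fst F))\<^sup>2 - 2) j"
proof -
  have fwd: "k < length ps - 1 \<Longrightarrow> fwd k \<longleftrightarrow> (ps ! k, ps ! Suc k) \<in> Q" for k
    using path by simp
  have "curve_matrix (puncture_turn Q (hd ps) l) = turn_matrix (turn_weights Q (hd ps) l)"
    "curve_matrix (puncture_turn Q (last ps) r) = turn_matrix \<rho>"
    using curve_matrix_puncture_turn[of "hd ps" "fst l" Q "snd l"] left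
      curve_matrix_puncture_turn[of "last ps" "fst r" Q "snd r"] right
    by (simp_all add: \<rho>_def)
  then show ?thesis
    using trace_curve_matrix[of fwd "length ps - 1" \<rho> "turn_weights Q (hd ps) l"]
    by (simp add: growth_coeff_def curve_L_def curve_matrix_append curve_matrix_forward[OF fwd]
        curve_matrix_backward[OF fwd] F_def \<rho>_def)
qed


section \<open>Neighbours in the quiver\<close>

lemma frieze_pos: "frieze Q i t > 0"
proof (induction Q i t rule: frieze.induct)
  case (2 Q i t)
  have "(\<Prod>j | (j, i) \<in> Q. frieze Q j t) \<ge> 0"
    using 2(1) by (intro prod_nonneg ballI less_imp_le) simp
  moreover have "(\<Prod>j | (i, j) \<in> Q \<and> j < i. frieze Q j (Suc t)) \<ge> 0"
    using 2(2) by (intro prod_nonneg ballI less_imp_le) simp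
  ultimately show ?case
    using 2(3) by (subst frieze.simps(2)) (intro divide_pos_pos add_pos_nonneg mult_nonneg_nonneg; simp)
qed simp

locale affine_D =
  fixes n Q l ps r
  assumes quiver: "affine_D_quiver n Q l ps r"
begin

abbreviation edges where "edges \<equiv> affine_D_edges l ps r"

definition nbrs :: "nat \<Rightarrow> nat set" where "nbrs i = {j. {i, j} \<in> edges}"

lemma n_ge: "n \<ge> 5" and length_ps: "length ps = n - 4"
  and distinct: "distinct ([fst l, snd l] @ ps @ [fst r, snd r])"
  and vertices: "set ([fst l, snd l] @ ps @ [fst r, snd r]) = {1..n}"
  and arrow_less: "(i, j) \<in> Q \<Longrightarrow> j < i"
  and edges: "edges = (\<lambda>(i, j). {i, j}) ` Q"
  using quiver unfolding affine_D_quiver_def by blast+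

lemma ps_nonempty [simp]: "ps \<noteq> []"
  using n_ge length_ps by auto

lemma hd_last: "hd ps = ps ! 0" "last ps = ps ! (length ps - 1)"
  by (simp_all add: hd_conv_nth last_conv_nth)

lemma arrow_asym: "(i, j) \<in> Q \<Longrightarrow> (j, i) \<notin> Q"
  using arrow_less less_asym by blast

lemma edge_iff: "j \<in> nbrs i \<longleftrightarrow> (i, j) \<in> Q \<or> (j, i) \<in> Q"
proof
  assume "j \<in> nbrs i"
  then obtain a b where "(a, b) \<in> Q" "{i, j} = {a, b}"
    unfolding nbrs_def edges by auto
  then show "(i, j) \<in> Q \<or> (j, i) \<in> Q" by (auto simp: doubleton_eq_iff)
next
  assume "(i, j) \<in> Q \<or> (j, i) \<in> Q"
  then have "\<exists>a b. (a, b) \<in> Q \<and> {i, j} = {a, b}" by blast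
  then show "j \<in> nbrs i" unfolding nbrs_def edges by auto
qed

lemma edge_cases: "j \<in> nbrs i \<Longrightarrow> (i, j) \<in> Q \<longleftrightarrow> (j, i) \<notin> Q"
  using edge_iff arrow_asym by blast

abbreviation leaves where "leaves \<equiv> {fst l, snd l, fst r, snd r}"

lemma leaf_not_path: "k < length ps \<Longrightarrow> a \<in> leaves \<Longrightarrow> ps ! k \<noteq> a"
proof -
  have "leaves \<inter> set ps = {}" using distinct by auto
  then show "k < length ps \<Longrightarrow> a \<in> leaves \<Longrightarrow> ps ! k \<noteq> a"
    using nth_mem[of k ps] by blast
qed

lemma path_nth_eq: "j < length ps \<Longrightarrow> k < length ps \<Longrightarrow> ps ! j = ps ! k \<longleftrightarrow> j = k"
  using distinct by (simp add: nth_eq_iff_index_eq)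

lemma leaves_distinct: "fst l \<noteq> snd l" "fst r \<noteq> snd r" "{fst l, snd l} \<inter> {fst r, snd r} = {}"
  using distinct by auto

lemma path_edge_iff:
  assumes "k < length ps"
  shows "(\<exists>j. {ps ! k, i} = {ps ! j, ps ! Suc j} \<and> Suc j < length ps) \<longleftrightarrow>
    k \<noteq> 0 \<and> i = ps ! (k - 1) \<or> Suc k < length ps \<and> i = ps ! Suc k" (is "?L \<longleftrightarrow> ?R")
proof
  assume ?L
  then obtain j where j: "{ps ! k, i} = {ps ! j, ps ! Suc j}" "Suc j < length ps" by blast
  then have "ps ! k = ps ! j \<and> i = ps ! Suc j \<or> ps ! k = ps ! Suc j \<and> i = ps ! j"
    by (auto simp: doubleton_eq_iff)
  then show ?R using path_nth_eq[OF assms, of j] path_nth_eq[OF assms, of "Suc j"] j(2) by auto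
next
  assume ?R
  then show ?L
  proof
    assume "k \<noteq> 0 \<and> i = ps ! (k - 1)"
    then show ?L using assms by (intro exI[of _ "k - 1"]) auto
  next
    assume "Suc k < length ps \<and> i = ps ! Suc k"
    then show ?L by (intro exI[of _ k]) auto
  qed
qed

lemma path_leaf_edge:
  assumes "k < length ps" "j < length ps" "a \<in> leaves"
  shows "{ps ! k, i} = {a, ps ! j} \<longleftrightarrow> k = j \<and> i = a"
  using path_nth_eq[OF assms(1,2)] leaf_not_path[OF assms(1,3)] unfolding doubleton_eq_iff by blast

lemma leaf_leaf_edge:
  assumes "j < length ps" "a \<in> leaves" "b \<in> leaves"
  shows "{b, i} = {a, ps ! j} \<longleftrightarrow> a = b \<and> i = ps ! j"
  using leaf_not_path[OF assms(1,3)] unfolding doubleton_eq_iff by blast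

lemma leaf_path_edge:
  assumes "a \<in> leaves"
  shows "\<not> (\<exists>j. {a, i} = {ps ! j, ps ! Suc j} \<and> Suc j < length ps)"
proof
  assume "\<exists>j. {a, i} = {ps ! j, ps ! Suc j} \<and> Suc j < length ps"
  then obtain j where "{a, i} = {ps ! j, ps ! Suc j}" and j: "Suc j < length ps" by blast
  then have "a = ps ! j \<or> a = ps ! Suc j" by (auto simp: doubleton_eq_iff)
  then show False using leaf_not_path[OF _ assms, of j] leaf_not_path[OF _ assms, of "Suc j"] j by auto
qed

lemma mem_edges_iff:
  "E \<in> edges \<longleftrightarrow>
    E = {fst l, ps ! 0} \<or> E = {snd l, ps ! 0} \<or>
    E = {fst r, ps ! (length ps - 1)} \<or> E = {snd r, ps ! (length ps - 1)} \<or>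
    (\<exists>j. E = {ps ! j, ps ! Suc j} \<and> Suc j < length ps)"
  by (simp add: affine_D_edges_def hd_last)

lemma nbrs_path:
  assumes k: "k < length ps"
  shows "nbrs (ps ! k) =
    (if k = 0 then {fst l, snd l} else {ps ! (k - 1)}) \<union>
    (if Suc k = length ps then {fst r, snd r} else {ps ! Suc k})" (is "_ = ?N")
proof -
  have *: "0 < length ps" "length ps - 1 < length ps" by simp_all
  have "k = length ps - 1 \<longleftrightarrow> Suc k = length ps" using k by auto
  then have "{ps ! k, i} \<in> edges \<longleftrightarrow>
      k = 0 \<and> i \<in> {fst l, snd l} \<or> Suc k = length ps \<and> i \<in> {fst r, snd r} \<or>
      k \<noteq> 0 \<and> i = ps ! (k - 1) \<or> Suc k < length ps \<and> i = ps ! Suc k" for i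
    unfolding mem_edges_iff path_edge_iff[OF k]
    by (simp add: path_leaf_edge[OF k *(1)] path_leaf_edge[OF k *(2), unfolded One_nat_def]) blast
  then have "i \<in> nbrs (ps ! k) \<longleftrightarrow> i \<in> ?N" for i
    unfolding nbrs_def mem_Collect_eq using k by (cases "k = 0"; cases "Suc k = length ps") auto
  then show ?thesis by blast
qed

lemma nbrs_left: "nbrs a = {ps ! 0}" if a: "a \<in> {fst l, snd l}"
proof -
  have *: "0 < length ps" "length ps - 1 < length ps" "a \<in> leaves" using a by auto
  have "a \<noteq> fst r" "a \<noteq> snd r" using distinct a by auto
  then have "{a, i} \<in> edges \<longleftrightarrow> i = ps ! 0" for i
    using a leaf_path_edge[OF *(3), of i] unfolding mem_edges_iff
    by (simp add: leaf_leaf_edge[OF *(1) _ *(3)] leaf_leaf_edge[OF *(2) _ *(3), unfolded One_nat_def]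
        del: ex_simps not_ex) blast
  then show ?thesis by (simp add: nbrs_def)
qed

lemma nbrs_right: "nbrs a = {ps ! (length ps - 1)}" if a: "a \<in> {fst r, snd r}"
proof -
  have *: "0 < length ps" "length ps - 1 < length ps" "a \<in> leaves" using a by auto
  have "a \<noteq> fst l" "a \<noteq> snd l" using distinct a by auto
  then have "{a, i} \<in> edges \<longleftrightarrow> i = ps ! (length ps - 1)" for i
    using a leaf_path_edge[OF *(3), of i] unfolding mem_edges_iff
    by (simp add: leaf_leaf_edge[OF *(1) _ *(3)] leaf_leaf_edge[OF *(2) _ *(3), unfolded One_nat_def]
        del: ex_simps not_ex) blast
  then show ?thesis by (simp add: nbrs_def)
qed

lemma vertex_cases:
  assumes "i \<in> {1..n}"
  obtains "i \<in> {fst l, snd l}" | "i \<in> {fst r, snd r}" | k where "k < length ps" "i = ps ! k"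
proof -
  have "i \<in> {fst l, snd l} \<or> i \<in> {fst r, snd r} \<or> i \<in> set ps"
    using assms unfolding vertices[symmetric] by auto
  then show thesis using that by (auto simp: in_set_conv_nth)
qed

lemma leaf_vertex: "a \<in> {fst l, snd l, fst r, snd r} \<Longrightarrow> a \<in> {1..n}"
  unfolding vertices[symmetric] by auto

lemma path_vertex: "k < length ps \<Longrightarrow> ps ! k \<in> {1..n}"
  unfolding vertices[symmetric] by auto

lemma finite_nbrs: "i \<in> {1..n} \<Longrightarrow> finite (nbrs i)"
  by (elim vertex_cases) (auto simp: nbrs_left nbrs_right nbrs_path)

lemma nbrs_vertices:
  assumes "i \<in> {1..n}" "j \<in> nbrs i"
  shows "j \<in> {1..n}"
  using assms(1)
proof (cases rule: vertex_cases)
  case 1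
  then have "j = ps ! 0" using assms(2) nbrs_left by blast
  then show ?thesis using path_vertex[of 0] by simp
next
  case 2
  then have "j = ps ! (length ps - 1)" using assms(2) nbrs_right by blast
  then show ?thesis using path_vertex[of "length ps - 1"] by simp
next
  case (3 k)
  then have "j \<in> {fst l, snd l, fst r, snd r} \<or>
      j = ps ! (k - 1) \<or> Suc k < length ps \<and> j = ps ! Suc k"
    using assms(2) by (auto simp: nbrs_path split: if_splits)
  then show ?thesis using leaf_vertex[of j] path_vertex[of "k - 1"] path_vertex[of "Suc k"] 3 by auto
qed

text \<open>
  The recursion determines the frieze, in the order in which it computes its values. Which values of
  the neighbours enter depends on the orientation of the edge only.
\<close>

lemma frieze_eqI:
  assumes init: "\<And>i. i \<in> {1..n} \<Longrightarrow> F i 0 = 1"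
    and rec: "\<And>i t. i \<in> {1..n} \<Longrightarrow>
      F i t * F i (Suc t) = 1 + (\<Prod>j\<in>nbrs i. F j (if (i, j) \<in> Q then Suc t else t))"
  shows "i \<in> {1..n} \<Longrightarrow> frieze Q i t = F i t"
proof -
  have "i \<in> {1..n} \<Longrightarrow> R = Q \<Longrightarrow> frieze R i t = F i t" for R
  proof (induction R i t rule: frieze.induct)
    case (1 R i)
    then show ?case using init by simp
  next
    case (2 R i t)
    let ?In = "{j. (j, i) \<in> Q}" and ?Out = "{j. (i, j) \<in> Q}"
    have union: "nbrs i = ?In \<union> ?Out" and disjoint: "?In \<inter> ?Out = {}"
      using edge_iff arrow_asym by blast+
    then have fin: "finite ?In" "finite ?Out" using finite_nbrs[OF 2(4)] by simp_all
    have "nbrs i \<subseteq> {1..n}" using nbrs_vertices[OF 2(4)] by blast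
    then have pred: "frieze Q j t = F j t" if "j \<in> ?In" for j
      using 2(1)[of j] 2(5) that union by auto
    have succ: "frieze Q j (Suc t) = F j (Suc t)" if "j \<in> ?Out" for j
    proof -
      have "j < i" using that arrow_less by blast
      then show ?thesis using 2(2)[of j] 2(5) that union \<open>nbrs i \<subseteq> {1..n}\<close> by auto
    qed
    have "(\<Prod>j\<in>?In. frieze Q j t) * (\<Prod>j\<in>?Out. frieze Q j (Suc t)) =
        (\<Prod>j\<in>?In. F j (if (i, j) \<in> Q then Suc t else t)) *
        (\<Prod>j\<in>?Out. F j (if (i, j) \<in> Q then Suc t else t))"
      using arrow_asym by (intro arg_cong2[where f = "(*)"] prod.cong) (auto simp: pred succ)
    also have "\<dots> = (\<Prod>j\<in>nbrs i. F j (if (i, j) \<in> Q then Suc t else t))"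
      using fin disjoint by (simp add: union prod.union_disjoint)
    finally have "frieze Q i t * frieze Q i (Suc t) = F i t * F i (Suc t)"
      using rec[OF 2(4), of t] frieze_Suc[OF quiver, of i t] frieze_pos[of Q i t] by simp
    moreover have "frieze Q i t = F i t" using 2(3,4,5) by simp
    ultimately show ?case using frieze_pos[of Q i t] 2(5) by simp
  qed
  then show "i \<in> {1..n} \<Longrightarrow> frieze Q i t = F i t" by simp
qed

end


section \<open>The frieze as a table of lambda lengths\<close>

text \<open>
  A leaf alternates between the plain and the notched arc at the puncture while its other end moves
  along the boundary. Notching an arc divides its lambda length by a factor that depends on the
  horocycle at the puncture; \<open>left_lambda\<close> and \<open>right_lambda\<close> are the geometric means of the two.
\<close>

definition tag_factor :: "real \<Rightarrow> nat \<Rightarrow> real" where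
  "tag_factor w t = (if even t then 1 / w else w)"

lemma tag_factor_Suc: "w \<noteq> 0 \<Longrightarrow> tag_factor w t * tag_factor w (Suc t) = 1"
  by (simp add: tag_factor_def)

text \<open>
  The mean lambda length at the initial position of the leaf, to be normalized to 1.
\<close>

definition leaf_weight :: "(nat \<times> nat) set \<Rightarrow> nat \<Rightarrow> nat \<times> nat \<Rightarrow> nat \<Rightarrow> real" where
  "leaf_weight Q v ab c =
     (if (v, c) \<in> Q then snd (turn_weights Q v ab) else fst (turn_weights Q v ab))"

lemma leaf_weight_nonzero: "leaf_weight Q v ab c \<noteq> 0"
  by (simp add: leaf_weight_def turn_weights_def split: bool.splits)

text \<open>
  Whenever the two leaves at one puncture end at the same boundary point, they carry opposite tags,
  so that the product of their values is the square of the mean lambda length.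
\<close>

lemma tag_factor_pair:
  "tag_factor (leaf_weight Q v (a, b) a) (if (v, a) \<in> Q then Suc t else t) *
   tag_factor (leaf_weight Q v (a, b) b) (if (v, b) \<in> Q then Suc t else t) = 1"
  by (simp add: tag_factor_def leaf_weight_def turn_weights_def)

context affine_D
begin

definition path_index :: "nat \<Rightarrow> nat" where
  "path_index i = (THE k. k < length ps \<and> ps ! k = i)"

lemma path_index: "k < length ps \<Longrightarrow> path_index (ps ! k) = k"
  unfolding path_index_def using path_nth_eq by (intro the_equality) auto

text \<open>
  Each step of time moves every arc by one boundary point. The proof defines the lambda lengths \<open>F\<close> of
  the moving arcs and checks the recursion: at non-leaf vertices it is the Ptolemy relation, where a
  neighbouring row that would lie beyond the end of the path is replaced by the product of two leaves;
  at the leaves it is \<open>arc_lambda_Suc\<close> or \<open>arc_lambda_Suc_period\<close>. The orientation enters through the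
  starting points only: an arrow shifts the starting point of one of its ends by one step, and this
  compensates for the difference between times \<open>t\<close> and \<open>t + 1\<close> in the recursion.
\<close>

lemma frieze_realization:
  obtains v u u' where
    "monodromic_sequence (n - 3) v u u'"
    "\<And>j. growth_coeff Q l ps r j = bracelet ((det2 u u')\<^sup>2 - 2) j"
    "\<And>k. k < length ps \<Longrightarrow>
      \<exists>s. \<forall>t. frieze Q (ps ! k) t = monodromic_sequence.arc_lambda v u (s + t) (s + t + k + 1)"
    "\<And>a. a \<in> {fst l, snd l} \<Longrightarrow>
      \<exists>s w. \<forall>t. frieze Q a t = monodromic_sequence.left_lambda v u (s + t) * tag_factor w t"
    "\<And>a. a \<in> {fst r, snd r} \<Longrightarrow>
      \<exists>s w. \<forall>t. frieze Q a t = monodromic_sequence.right_lambda v u' (s + t) * tag_factor w t"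
proof -
  define K where "K = length ps - 1"
  have len: "length ps = Suc K" and m: "n - 3 = K + 2"
    using n_ge length_ps by (simp_all add: K_def)
  define fwd where "fwd k \<longleftrightarrow> (ps ! k, ps ! Suc k) \<in> Q" for k
  define x where "x k = Suc (fwd_count fwd K - fwd_count fwd k)" for k
  define q where "q = turn_weights Q (ps ! 0) l"
  define \<rho> where "\<rho> = turn_weights Q (ps ! K) r"
  define u' where "u' = fst \<rho> *\<^sub>R snd (frame fwd K) - snd \<rho> *\<^sub>R fst (frame fwd K)"
  obtain v where v: "monodromic_sequence (K + 2) v q u'"
    and left_init: "monodromic_sequence.left_lambda v q (x 0) = snd q"
      "monodromic_sequence.left_lambda v q (Suc (x 0)) = fst q"
    and right_init: "monodromic_sequence.right_lambda v u' 1 = fst \<rho>"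
      "monodromic_sequence.right_lambda v u' 0 = snd \<rho>"
    and arc_init: "\<And>k. k \<le> K \<Longrightarrow> monodromic_sequence.arc_lambda v q (x k) (x k + k + 1) = 1"
    using slice_realization[where ?q1.0 = "fst q" and ?q2.0 = "snd q" and ?r1.0 = "fst \<rho>"
        and ?r2.0 = "snd \<rho>" and fwd = fwd and K = K]
    unfolding q_def \<rho>_def u'_def x_def by (auto simp: turn_weights_prod)
  interpret monodromic_sequence "K + 2" v q u' by (fact v)
  \<comment> \<open>Starting points of the left leaves, the right leaves and, as \<open>x\<close> above, of the path.\<close>
  define Sl where "Sl a = (if (ps ! 0, a) \<in> Q then x 0 else Suc (x 0))" for a
  define Sr :: "nat \<Rightarrow> nat" where "Sr a = (if (ps ! K, a) \<in> Q then 0 else 1)" for a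
  define F where "F i t =
    (if i \<in> {fst l, snd l} then left_lambda (Sl i + t) * tag_factor (leaf_weight Q (ps ! 0) l i) t
     else if i \<in> {fst r, snd r} then right_lambda (Sr i + t) * tag_factor (leaf_weight Q (ps ! K) r i) t
     else arc_lambda (x (path_index i) + t) (x (path_index i) + t + path_index i + 1))" for i t
  have F_left: "F a t = left_lambda (Sl a + t) * tag_factor (leaf_weight Q (ps ! 0) l a) t"
    if "a \<in> {fst l, snd l}" for a t
    using that by (simp only: F_def if_True)
  have F_right: "F a t = right_lambda (Sr a + t) * tag_factor (leaf_weight Q (ps ! K) r a) t"
    if "a \<in> {fst r, snd r}" for a t
  proof -
    have "a \<notin> {fst l, snd l}" using that distinct by auto
    then show ?thesis using that by (simp only: F_def if_True if_False)
  qed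
  have F_path: "F (ps ! k) t = arc_lambda (x k + t) (x k + t + k + 1)" if "k \<le> K" for k t
  proof -
    have k: "k < length ps" using that len by simp
    then have "ps ! k \<notin> {fst l, snd l}" "ps ! k \<notin> {fst r, snd r}"
      using leaf_not_path by blast+
    then show ?thesis by (simp only: F_def if_False path_index[OF k])
  qed
  have orient: "(a, ps ! 0) \<in> Q \<longleftrightarrow> (ps ! 0, a) \<notin> Q" if "a \<in> {fst l, snd l}" for a
    using edge_cases[of "ps ! 0" a] nbrs_left[OF that] by blast
  have orient': "(a, ps ! K) \<in> Q \<longleftrightarrow> (ps ! K, a) \<notin> Q" if "a \<in> {fst r, snd r}" for a
    using edge_cases[of "ps ! K" a] nbrs_right[OF that] by (simp add: len)
  have fwd_iff: "(ps ! Suc k, ps ! k) \<in> Q \<longleftrightarrow> \<not> fwd k" if "k < K" for k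
    using edge_cases[of "ps ! k" "ps ! Suc k"] nbrs_path[of "Suc k"] that len by (simp add: fwd_def)
  have x_Suc: "x k = (if fwd k then Suc (x (Suc k)) else x (Suc k))" if "k < K" for k
    using fwd_count_mono[of "Suc k" K fwd] that by (cases "fwd k") (simp_all add: x_def)
  have x_K: "x K = 1" by (simp add: x_def)

  have "frieze Q i t = F i t" if "i \<in> {1..n}" for i t
    using that
  proof (rule frieze_eqI[rotated 2])
    show "F i 0 = 1" if "i \<in> {1..n}" for i
      using that
    proof (cases rule: vertex_cases)
      case 1
      then show ?thesis
        using leaf_weight_nonzero[of Q "ps ! 0" l i] left_init
        by (simp only: F_left) (simp add: Sl_def leaf_weight_def q_def tag_factor_def split: if_splits)
    next
      case 2
      then show ?thesis
        using leaf_weight_nonzero[of Q "ps ! K" r i] right_init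
        by (simp only: F_right) (simp add: Sr_def leaf_weight_def \<rho>_def tag_factor_def split: if_splits)
    next
      case (3 k)
      then show ?thesis using F_path[of k 0] arc_init[of k] len by simp
    qed
  next
    fix i t
    assume "i \<in> {1..n}"
    then show "F i t * F i (Suc t) = 1 + (\<Prod>j\<in>nbrs i. F j (if (i, j) \<in> Q then Suc t else t))"
    proof (cases rule: vertex_cases)
      case 1
      have "F i t * F i (Suc t) = left_lambda (Sl i + t) * left_lambda (Suc (Sl i + t)) *
          (tag_factor (leaf_weight Q (ps ! 0) l i) t * tag_factor (leaf_weight Q (ps ! 0) l i) (Suc t))"
        by (simp only: F_left[OF 1] add_Suc_right mult_ac)
      also have "\<dots> = 1 + arc_lambda (Sl i + t) (Suc (Sl i + t))"
        by (simp add: tag_factor_Suc leaf_weight_nonzero arc_lambda_Suc)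
      also have "arc_lambda (Sl i + t) (Suc (Sl i + t)) = F (ps ! 0) (if (i, ps ! 0) \<in> Q then Suc t else t)"
        using orient[OF 1] by (simp add: F_path Sl_def)
      finally show ?thesis by (simp add: nbrs_left[OF 1])
    next
      case 2
      have "F i t * F i (Suc t) = right_lambda (Sr i + t) * right_lambda (Suc (Sr i + t)) *
          (tag_factor (leaf_weight Q (ps ! K) r i) t * tag_factor (leaf_weight Q (ps ! K) r i) (Suc t))"
        by (simp only: F_right[OF 2] add_Suc_right mult_ac)
      also have "\<dots> = 1 + arc_lambda (Suc (Sr i + t)) (Sr i + t + (K + 2))"
        unfolding tag_factor_Suc[OF leaf_weight_nonzero] arc_lambda_Suc_period by simp
      also have "arc_lambda (Suc (Sr i + t)) (Sr i + t + (K + 2)) = F (ps ! K) (if (i, ps ! K) \<in> Q then Suc t else t)"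
        using orient'[OF 2] by (simp add: F_path Sr_def x_K)
      finally show ?thesis by (simp add: nbrs_right[OF 2] len)
    next
      case (3 k)
      define G where "G j = F j (if (i, j) \<in> Q then Suc t else t)" for j
      \<comment> \<open>The neighbours on the side of the left end and on the side of the right end.\<close>
      define A where "A = (if k = 0 then {fst l, snd l} else {ps ! (k - 1)})"
      define B where "B = (if Suc k = length ps then {fst r, snd r} else {ps ! Suc k})"
      have k: "k \<le> K" using 3 len by simp
      have path_apart: "ps ! (k - 1) \<notin> {fst r, snd r}"
        "Suc k \<noteq> length ps \<Longrightarrow> ps ! Suc k \<notin> {fst l, snd l}"
        using leaf_not_path[of "k - 1"] leaf_not_path[of "Suc k"] 3(1) less_imp_diff_less[of k]
          Suc_lessI[of k "length ps"] by blast+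
      have "k \<noteq> 0 \<Longrightarrow> Suc k \<noteq> length ps \<Longrightarrow> ps ! (k - 1) \<noteq> ps ! Suc k"
        using path_nth_eq[of "k - 1" "Suc k"] 3(1) by simp
      with path_apart have "A \<inter> B = {}"
        unfolding A_def B_def
        using leaves_distinct(3) by (cases "k = 0"; cases "Suc k = length ps") auto
      then have prod_nbrs: "prod G (nbrs i) = prod G A * prod G B"
        using 3 nbrs_path[of k] unfolding A_def[symmetric] B_def[symmetric]
        by (simp add: prod.union_disjoint A_def B_def)
      have A: "prod G A = arc_lambda (Suc (x k + t)) (x k + t + k + 1)"
      proof (cases k)
        case 0
        have leaf: "G a = left_lambda (Suc (x 0 + t)) *
            tag_factor (leaf_weight Q (ps ! 0) l a) (if (ps ! 0, a) \<in> Q then Suc t else t)"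
          if "a \<in> {fst l, snd l}" for a
          using that 0 3 by (simp add: G_def F_left[OF that] Sl_def)
        have "prod G A = G (fst l) * G (snd l)"
          using 0 leaves_distinct(1) by (simp add: A_def)
        also have "\<dots> = (left_lambda (Suc (x 0 + t)))\<^sup>2"
          using tag_factor_pair[of Q "ps ! 0" "fst l" "snd l" t]
          by (simp add: leaf power2_eq_square)
        finally show ?thesis using 0 by (simp add: arc_lambda_diagonal)
      next
        case (Suc k')
        then show ?thesis using 3 k fwd_iff[of k'] x_Suc[of k']
          by (simp add: A_def G_def F_path)
      qed
      have B: "prod G B = arc_lambda (x k + t) (Suc (x k + t + k + 1))"
      proof (cases "k = K")
        case True
        have leaf: "G a = right_lambda (Suc t) *
            tag_factor (leaf_weight Q (ps ! K) r a) (if (ps ! K, a) \<in> Q then Suc t else t)"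
          if "a \<in> {fst r, snd r}" for a
          using that True 3 by (simp add: G_def F_right[OF that] Sr_def)
        have "prod G B = G (fst r) * G (snd r)"
          using True len leaves_distinct(2) by (simp add: B_def)
        also have "\<dots> = (right_lambda (Suc t))\<^sup>2"
          using tag_factor_pair[of Q "ps ! K" "fst r" "snd r" t]
          by (simp add: leaf power2_eq_square)
        finally show ?thesis using True arc_lambda_period[of "Suc t"] by (simp add: x_K)
      next
        case False
        then show ?thesis using 3 k len x_Suc[of k]
          by (simp add: B_def G_def F_path fwd_def)
      qed
      have "F i t * F i (Suc t) = 1 + prod G A * prod G B"
        using arc_lambda_Ptolemy[of "x k + t" "x k + t + k + 1"] by (simp add: A B F_path[OF k] 3)
      then show ?thesis by (simp only: G_def[symmetric] prod_nbrs)
    qed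
  qed
  note frieze_F = this
  show thesis
  proof
    show "monodromic_sequence (n - 3) v q u'" using v by (simp only: m)
    show "growth_coeff Q l ps r j = bracelet ((det2 q u')\<^sup>2 - 2) j" for j
      using growth_coeff_eq[of ps fwd Q l r j] edge_cases nbrs_left nbrs_right
      by (simp add: fwd_def len hd_last q_def u'_def \<rho>_def orient orient')
    show "\<exists>s. \<forall>t. frieze Q (ps ! k) t = arc_lambda (s + t) (s + t + k + 1)" if "k < length ps" for k
      using frieze_F[OF path_vertex[OF that]] F_path[of k] that len by (intro exI[of _ "x k"]) simp
    show "\<exists>s w. \<forall>t. frieze Q a t = left_lambda (s + t) * tag_factor w t" if "a \<in> {fst l, snd l}" for a
    proof -
      have "a \<in> {1..n}" using leaf_vertex that by blast
      then have "\<forall>t. frieze Q a t = left_lambda (Sl a + t) * tag_factor (leaf_weight Q (ps ! 0) l a) t"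
        by (simp only: frieze_F F_left[OF that]) simp
      then show ?thesis by blast
    qed
    show "\<exists>s w. \<forall>t. frieze Q a t = right_lambda (s + t) * tag_factor w t" if "a \<in> {fst r, snd r}" for a
    proof -
      have "a \<in> {1..n}" using leaf_vertex that by blast
      then have "\<forall>t. frieze Q a t = right_lambda (Sr a + t) * tag_factor (leaf_weight Q (ps ! K) r a) t"
        by (simp only: frieze_F F_right[OF that]) simp
      then show ?thesis by blast
    qed
  qed
qed

end

text \<open>
  Comparing two values of a leaf at times which differ by an odd number changes the tag. This is why an
  even \<open>m\<close>, or an even number of full turns, is needed.
\<close>

lemma tagged_leaf_recurrence:
  assumes rec: "\<And>x. s (x + 2 * m) = c * s (x + m) - (s x :: real)"
    and f: "\<And>t. f t = s (x + t) * tag_factor w t"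
  shows "even m \<Longrightarrow> f (t + 2 * m) = c * f (t + m) - f t"
    and "f (t + 4 * m) = bracelet c 2 * f (t + 2 * m) - f t"
proof -
  assume "even m"
  have "s (x + (t + 2 * m)) = c * s (x + (t + m)) - s (x + t)"
    using rec[of "x + t"] by (simp add: add.assoc)
  moreover have "tag_factor w (t + 2 * m) = tag_factor w t" "tag_factor w (t + m) = tag_factor w t"
    using \<open>even m\<close> by (simp_all add: tag_factor_def)
  ultimately show "f (t + 2 * m) = c * f (t + m) - f t"
    by (simp add: f left_diff_distrib)
next
  have "s (x + (t + 4 * m)) = bracelet c 2 * s (x + (t + 2 * m)) - s (x + t)"
    using bracelet_step[where s = s, OF rec, of "x + t" 2] by (simp add: add.assoc)
  moreover have "tag_factor w (t + 4 * m) = tag_factor w t"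
    "tag_factor w (t + 2 * m) = tag_factor w t"
    by (simp_all add: tag_factor_def)
  ultimately show "f (t + 4 * m) = bracelet c 2 * f (t + 2 * m) - f t"
    by (simp add: f left_diff_distrib)
qed

theorem theorem3p8:
  fixes n :: nat and Q :: "(nat \<times> nat) set"
    and l r :: "nat \<times> nat" and ps :: "nat list"
  assumes "affine_D_quiver n Q l ps r"
  defines "f \<equiv> frieze Q" and "C \<equiv> growth_coeff Q l ps r"
  shows "(\<forall>i \<in> set ps. \<forall>t p :: nat.
            f i (t + 3 * p * (n - 3)) =
              (C (2 * p) + 1) * f i (t + 2 * p * (n - 3))
              - (C (2 * p) + 1) * f i (t + p * (n - 3)) + f i t) \<and>
         (\<forall>i \<in> {fst l, snd l, fst r, snd r}. \<forall>t :: nat.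
            (odd n \<longrightarrow> f i (t + 2 * (n - 3)) = C 1 * f i (t + (n - 3)) - f i t) \<and>
            f i (t + 4 * (n - 3)) = C 2 * f i (t + 2 * (n - 3)) - f i t)"
proof -
  interpret affine_D n Q l ps r by unfold_locales (fact assms(1))
  obtain v u u' where v: "monodromic_sequence (n - 3) v u u'"
    and C: "\<And>j. C j = bracelet ((det2 u u')\<^sup>2 - 2) j"
    and path: "\<And>k. k < length ps \<Longrightarrow>
      \<exists>s. \<forall>t. f (ps ! k) t = monodromic_sequence.arc_lambda v u (s + t) (s + t + k + 1)"
    and leaf_l: "\<And>a. a \<in> {fst l, snd l} \<Longrightarrow>
      \<exists>s w. \<forall>t. f a t = monodromic_sequence.left_lambda v u (s + t) * tag_factor w t"
    and leaf_r: "\<And>a. a \<in> {fst r, snd r} \<Longrightarrow>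
      \<exists>s w. \<forall>t. f a t = monodromic_sequence.right_lambda v u' (s + t) * tag_factor w t"
    using frieze_realization unfolding f_def C_def by blast
  interpret monodromic_sequence "n - 3" v u u' by (fact v)
  have parity: "odd n \<Longrightarrow> even (n - 3)" using n_ge by simp
  show ?thesis
  proof (intro conjI ballI allI)
    fix i t p
    assume "i \<in> set ps"
    then obtain k where "k < length ps" "i = ps ! k" by (auto simp: in_set_conv_nth)
    then obtain s where s: "\<And>t. f i t = arc_lambda (s + t) (s + t + k + 1)" using path by blast
    show "f i (t + 3 * p * (n - 3)) =
        (C (2 * p) + 1) * f i (t + 2 * p * (n - 3)) - (C (2 * p) + 1) * f i (t + p * (n - 3)) + f i t"
      using arc_lambda_recurrence[of "s + t" p "s + t + k + 1"] by (simp add: s C add_ac)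
  next
    fix i t
    assume i: "i \<in> {fst l, snd l, fst r, snd r}"
    then consider (left) "i \<in> {fst l, snd l}" | (right) "i \<in> {fst r, snd r}" by blast
    then have "(odd n \<longrightarrow> f i (t + 2 * (n - 3)) = C 1 * f i (t + (n - 3)) - f i t) \<and>
        f i (t + 4 * (n - 3)) = C 2 * f i (t + 2 * (n - 3)) - f i t"
    proof cases
      case left
      then obtain s w where "\<And>t. f i t = left_lambda (s + t) * tag_factor w t"
        using leaf_l by blast
      from tagged_leaf_recurrence[where s = left_lambda, OF left_lambda_recurrence this] show ?thesis
        using parity by (simp add: C)
    next
      case right
      then obtain s w where "\<And>t. f i t = right_lambda (s + t) * tag_factor w t"
        using leaf_r by blast
      from tagged_leaf_recurrence[where s = right_lambda, OF right_lambda_recurrence this] show ?thesis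
        using parity by (simp add: C)
    qed
    then show "odd n \<longrightarrow> f i (t + 2 * (n - 3)) = C 1 * f i (t + (n - 3)) - f i t"
      "f i (t + 4 * (n - 3)) = C 2 * f i (t + 2 * (n - 3)) - f i t"
      by blast+
  qed
qed

end
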